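(* Let $G=(V,E)$ be a finite graph with arbitrary real coupling constants $(J_e)_{e\in E}$ and $(U_e)_{e\in E}$, and let $A,B\subseteq V$. Then the correlations of the Ashkin--Teller model on $G$ satisfy $$\langle \sigma_A\tilde\sigma_B\rangle=\frac1{Z_\emptyset}\sum_{\mathbf n=(\omega,\eta)\in\Omega_{A\triangle B}} w(\mathbf n)\,\mathbf 1\{\omega\in\mathfrak F_B\},$$ where $\triangle$ denotes the symmetric difference, and $\omega\in\mathfrak F_B$ if and only if each connected component of $(V,\omega)$ contains an even number of vertices from $B$.
   Context: The Ashkin--Teller model (free boundary conditions) on a finite graph $G=(V,E)$ with real coupling constants $J_e,U_e$ is the probability measure on pairs $(\sigma,\tilde\sigma)\in\{-1,1\}^V\times\{-1,1\}^V$ given by $$\mathbf P(\sigma,\tilde\sigma)=\frac1{\mathcal Z}\prod_{uv\in E}\exp\big(J_{uv}(\sigma_u\sigma_v+\tilde\sigma_u\tilde\sigma_v)+U_{uv}(\sigma_u\sigma_v\tilde\sigma_u\tilde\sigma_v+1)\big),$$ with $\mathcal Z$ the normalizing constant; $\langle\cdot\rangle$ is the expectation. For $A\subseteq V$, $\sigma_A=\prod_{v\in A}\sigma_v$, $\tilde\sigma_A=\prod_{v\in A}\tilde\sigma_v$, and $\sigma_\emptyset=\tilde\sigma_\emptyset=1$. Currents: for $\eta\subseteq E$, $\delta(\eta)$ is the set of vertices of odd degree in $(V,\eta)$. A current with sources $A\subseteq V$ is a pair $\mathbf n=(\omega,\eta)$ with $\eta\subseteq\omega\subseteq E$ and $\delta(\eta)=A$.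 $\Omega_A$ is the set of all currents with sources $A$ if $|A|$ is even, and $\Omega_A=\emptyset$ otherwise. The weight of a current is $$w(\mathbf n)=2^{k(\omega)}\prod_{e\in\eta}x_e\prod_{e\in\omega\setminus\eta}y_e,\qquad x_e=e^{2U_e}\sinh(2J_e),\quad y_e=e^{2U_e}\cosh(2J_e)-1,$$ where $k(\omega)$ is the number of connected components of $(V,\omega)$, including isolated vertices. $Z_\emptyset=\sum_{\mathbf n\in\Omega_\emptyset}w(\mathbf n)$. *)

theory Defs
  imports "HOL-Probability.Probability"
begin

definition finite_graph :: "'a set \<Rightarrow> 'a set set \<Rightarrow> bool" where
  "finite_graph V E \<longleftrightarrow> finite V \<and> (\<forall>e\<in>E. e \<subseteq> V \<and> card e = 2)"

lemma finite_graph_edges_finite: "finite_graph V E \<Longrightarrow> finite E"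
  unfolding finite_graph_def by (meson Sup_least finite_UnionD finite_subset)

definition spin_configs :: "'a set \<Rightarrow> ('a \<Rightarrow> real) set" where
  "spin_configs V = V \<rightarrow>\<^sub>E {-1, 1}"

text \<open>For an edge \<open>e = {u, v}\<close>, \<open>spin \<sigma> e\<close> is the product of the two spins at its endpoints.\<close>

definition spin :: "('a \<Rightarrow> real) \<Rightarrow> 'a set \<Rightarrow> real" where
  "spin \<sigma> A = (\<Prod>v\<in>A. \<sigma> v)"

definition at_weight ::
  "'a set set \<Rightarrow> ('a set \<Rightarrow> real) \<Rightarrow> ('a set \<Rightarrow> real) \<Rightarrow> ('a \<Rightarrow> real) \<times> ('a \<Rightarrow> real) \<Rightarrow> real" where
  "at_weight E J U = (\<lambda>(\<sigma>, \<sigma>').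
     \<Prod>e\<in>E. exp (J e * (spin \<sigma> e + spin \<sigma>' e) + U e * (spin \<sigma> e * spin \<sigma>' e + 1)))"

definition at_partition ::
  "'a set \<Rightarrow> 'a set set \<Rightarrow> ('a set \<Rightarrow> real) \<Rightarrow> ('a set \<Rightarrow> real) \<Rightarrow> real" where
  "at_partition V E J U = (\<Sum>s \<in> spin_configs V \<times> spin_configs V. at_weight E J U s)"

definition ashkin_teller ::
  "'a set \<Rightarrow> 'a set set \<Rightarrow> ('a set \<Rightarrow> real) \<Rightarrow> ('a set \<Rightarrow> real)
    \<Rightarrow> (('a \<Rightarrow> real) \<times> ('a \<Rightarrow> real)) measure" where
  "ashkin_teller V E J U =
     point_measure (spin_configs V \<times> spin_configs V)
       (\<lambda>s. ennreal (at_weight E J U s / at_partition V E J U))"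

lemma finite_spin_configs: "finite V \<Longrightarrow> finite (spin_configs V)"
  unfolding spin_configs_def by (intro finite_PiE) auto

lemma spin_configs_nonempty: "spin_configs V \<noteq> {}"
  unfolding spin_configs_def by (simp add: PiE_eq_empty_iff)

lemma at_weight_pos: "at_weight E J U s > 0"
  unfolding at_weight_def by (auto intro!: prod_pos split: prod.split)

lemma at_partition_pos: "finite V \<Longrightarrow> at_partition V E J U > 0"
  unfolding at_partition_def
  by (intro sum_pos) (auto simp: finite_spin_configs spin_configs_nonempty at_weight_pos)

lemma prob_space_ashkin_teller:
  assumes "finite V"
  shows "prob_space (ashkin_teller V E J U)"
proof
  let ?S = "spin_configs V \<times> spin_configs V"
  have fin: "finite ?S" using assms by (simp add: finite_spin_configs)
  have "emeasure (ashkin_teller V E J U) (space (ashkin_teller V E J U))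
      = (\<Sum>s\<in>?S. ennreal (at_weight E J U s / at_partition V E J U))"
    unfolding ashkin_teller_def space_point_measure
    by (rule emeasure_point_measure_finite) (use fin in auto)
  also have "\<dots> = ennreal (\<Sum>s\<in>?S. at_weight E J U s / at_partition V E J U)"
    by (rule sum_ennreal)
       (simp add: less_imp_le[OF at_weight_pos] less_imp_le[OF at_partition_pos[OF assms]])
  also have "(\<Sum>s\<in>?S. at_weight E J U s / at_partition V E J U) = 1"
    using at_partition_pos[OF assms, of E J U]
    by (simp add: sum_divide_distrib[symmetric] at_partition_def)
  finally show "emeasure (ashkin_teller V E J U) (space (ashkin_teller V E J U)) = 1"
    by simp
qed

definition odd_vertices :: "'a set \<Rightarrow> 'a set set \<Rightarrow> 'a set" where
  "odd_vertices V \<eta> = {v \<in> V. odd (card {e \<in> \<eta>. v \<in> e})}"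

definition currents :: "'a set \<Rightarrow> 'a set set \<Rightarrow> 'a set \<Rightarrow> ('a set set \<times> 'a set set) set" where
  "currents V E A =
     (if even (card A) then {(\<omega>, \<eta>). \<eta> \<subseteq> \<omega> \<and> \<omega> \<subseteq> E \<and> odd_vertices V \<eta> = A} else {})"

definition connectivity :: "'a set \<Rightarrow> 'a set set \<Rightarrow> ('a \<times> 'a) set" where
  "connectivity V \<omega> = {(u, v). {u, v} \<in> \<omega>}\<^sup>* \<inter> V \<times> V"

lemma equiv_connectivity: "equiv V (connectivity V \<omega>)"
proof (rule equivI)
  show "refl_on V (connectivity V \<omega>)"
    by (auto simp: connectivity_def refl_on_def)
  have "sym {(u, v). {u, v} \<in> \<omega>}" by (auto simp: sym_def insert_commute)
  from sym_rtrancl[OF this] show "sym (connectivity V \<omega>)"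
    by (auto simp: connectivity_def sym_def)
  show "trans (connectivity V \<omega>)"
    by (auto simp: connectivity_def trans_def)
qed (auto simp: connectivity_def)

text \<open>The connected components of the spanning subgraph \<open>(V, \<omega>)\<close>, as vertex sets;
  an isolated vertex \<open>v\<close> contributes the component \<open>{v}\<close>.\<close>

definition components :: "'a set \<Rightarrow> 'a set set \<Rightarrow> 'a set set" where
  "components V \<omega> = V // connectivity V \<omega>"

definition current_weight ::
  "'a set \<Rightarrow> ('a set \<Rightarrow> real) \<Rightarrow> ('a set \<Rightarrow> real) \<Rightarrow> 'a set set \<times> 'a set set \<Rightarrow> real" where
  "current_weight V J U = (\<lambda>(\<omega>, \<eta>).
     2 ^ card (components V \<omega>)
     * (\<Prod>e\<in>\<eta>. exp (2 * U e) * sinh (2 * J e))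
     * (\<Prod>e\<in>\<omega> - \<eta>. (exp (2 * U e) * cosh (2 * J e) - 1)))"

definition even_components :: "'a set \<Rightarrow> 'a set \<Rightarrow> 'a set set set" where
  "even_components V B = {\<omega>. \<forall>C \<in> components V \<omega>. even (card (C \<inter> B))}"

end

theory Submission
  imports Defs
begin

text \<open>Substitute \<open>\<tau> = \<sigma> \<sigma>'\<close>. The weight of an edge \<open>e\<close> becomes \<open>1\<close> if \<open>\<tau>\<^sub>e = -1\<close> and
  \<open>1 + y\<^sub>e + x\<^sub>e \<sigma>\<^sub>e\<close> if \<open>\<tau>\<^sub>e = 1\<close>. Expanding the product over the edges gives a sum over
  currents \<open>(\<omega>, \<eta>)\<close>. Summation over \<open>\<sigma>\<close> yields \<open>2 ^ card V\<close> times the indicator that the sources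
  of \<open>\<eta>\<close> are \<open>A \<triangle> B\<close>. Since \<open>\<tau>\<close> is constant on the components of \<open>\<omega>\<close>, summation over
  \<open>\<tau>\<close> yields \<open>2 ^ k(\<omega>)\<close> times the indicator that \<open>B\<close> meets every component evenly.\<close>

section \<open>Products of spins and their sums over all configurations\<close>

lemma spin_configsD: "\<sigma> \<in> spin_configs V \<Longrightarrow> v \<in> V \<Longrightarrow> \<sigma> v = -1 \<or> \<sigma> v = 1"
  by (auto simp: spin_configs_def PiE_iff)

lemma spin_square:
  assumes "\<sigma> \<in> spin_configs V" "C \<subseteq> V"
  shows "spin \<sigma> C * spin \<sigma> C = 1"
proof -
  have "(\<Prod>v\<in>C. \<sigma> v * \<sigma> v) = 1"
    using spin_configsD[OF assms(1)] assms(2) by (intro prod.neutral) fastforce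
  then show ?thesis by (simp add: spin_def prod.distrib)
qed

lemma spin_cases:
  assumes "\<sigma> \<in> spin_configs V" "C \<subseteq> V"
  shows "spin \<sigma> C = 1 \<or> spin \<sigma> C = -1"
  using spin_square[OF assms] by (metis square_eq_1_iff)

text \<open>Vertices of \<open>A \<inter> B\<close> occur twice on the right, and spins square to
  one.\<close>

lemma spin_sym_diff:
  assumes "finite V" "\<sigma> \<in> spin_configs V" "A \<subseteq> V" "B \<subseteq> V"
  shows "spin \<sigma> (sym_diff A B) = spin \<sigma> A * spin \<sigma> B"
proof -
  have fin: "finite A" "finite B" using assms finite_subset by blast+
  have A: "spin \<sigma> A = spin \<sigma> (A - B) * spin \<sigma> (A \<inter> B)"
    unfolding spin_def using fin
    by (subst prod.union_disjoint[symmetric]) (auto intro!: prod.cong)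
  have B: "spin \<sigma> B = spin \<sigma> (B - A) * spin \<sigma> (A \<inter> B)"
    unfolding spin_def using fin
    by (subst prod.union_disjoint[symmetric]) (auto intro!: prod.cong)
  have AB: "spin \<sigma> (sym_diff A B) = spin \<sigma> (A - B) * spin \<sigma> (B - A)"
    unfolding spin_def using fin by (subst prod.union_disjoint) auto
  have "spin \<sigma> (A \<inter> B) * spin \<sigma> (A \<inter> B) = 1"
    using assms by (intro spin_square) auto
  then show ?thesis unfolding A B AB by (simp add: algebra_simps)
qed

text \<open>Monomials indexed by all of \<open>V\<close> can be multiplied by adding exponents,
  whatever sets the factors come from.\<close>

lemma spin_eq_prod_powers:
  assumes "finite V" "C \<subseteq> V"
  shows "spin \<sigma> C = (\<Prod>v\<in>V. \<sigma> v ^ (if v \<in> C then 1 else 0))"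
proof -
  have "(\<Prod>v\<in>V. \<sigma> v ^ (if v \<in> C then 1 else 0)) = (\<Prod>v\<in>V. if v \<in> C then \<sigma> v else 1)"
    by (intro prod.cong) auto
  also have "\<dots> = (\<Prod>v\<in>V \<inter> C. \<sigma> v)"
    using assms(1) by (subst prod.inter_restrict) auto
  also have "V \<inter> C = C" using assms(2) by blast
  finally show ?thesis by (simp add: spin_def)
qed

text \<open>The sum factorizes over \<open>V\<close>, each factor being
  \<open>1 + (-1) ^ n v\<close>. It is used twice: for the vertices of the graph, and later with the
  set of components in place of \<open>V\<close>.\<close>

lemma sum_spin_configs_powers:
  assumes "finite V"
  shows "(\<Sum>\<sigma>\<in>spin_configs V. \<Prod>v\<in>V. \<sigma> v ^ n v) =
    (if \<forall>v\<in>V. even (n v) then 2 ^ card V else 0)"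
proof -
  have "(\<Sum>\<sigma>\<in>spin_configs V. \<Prod>v\<in>V. \<sigma> v ^ n v) = (\<Prod>v\<in>V. \<Sum>s\<in>{-1, 1::real}. s ^ n v)"
    unfolding spin_configs_def using assms by (subst prod_sum_PiE) auto
  also have "\<dots> = (\<Prod>v\<in>V. if even (n v) then 2 else 0)"
    by (intro prod.cong) (auto simp: power_minus_odd)
  also have "\<dots> = (if \<forall>v\<in>V. even (n v) then 2 ^ card V else 0)"
    using assms by auto
  finally show ?thesis .
qed

text \<open>The exponent of \<open>\<sigma> v\<close> is the degree of \<open>v\<close> in
  \<open>\<eta>\<close>, plus one if \<open>v \<in> C\<close>. All exponents are even exactly when
  the vertices of odd degree are those of \<open>C\<close>.\<close>

lemma sum_spin_times_edges:
  assumes "finite V" "finite \<eta>" "\<And>e. e \<in> \<eta> \<Longrightarrow> e \<subseteq> V" "C \<subseteq> V"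
  shows "(\<Sum>\<sigma>\<in>spin_configs V. spin \<sigma> C * (\<Prod>e\<in>\<eta>. spin \<sigma> e)) =
    (if odd_vertices V \<eta> = C then 2 ^ card V else 0)"
proof -
  have "spin \<sigma> C * (\<Prod>e\<in>\<eta>. spin \<sigma> e) =
      (\<Prod>v\<in>V. \<sigma> v ^ ((if v \<in> C then 1 else 0) + card {e \<in> \<eta>. v \<in> e}))" for \<sigma> :: "'a \<Rightarrow> real"
  proof -
    have "(\<Prod>e\<in>\<eta>. spin \<sigma> e) = (\<Prod>e\<in>\<eta>. \<Prod>v\<in>V. \<sigma> v ^ (if v \<in> e then 1 else 0))"
      using assms by (intro prod.cong) (auto simp: spin_eq_prod_powers)
    also have "\<dots> = (\<Prod>v\<in>V. \<Prod>e\<in>\<eta>. \<sigma> v ^ (if v \<in> e then 1 else 0))"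
      by (rule prod.swap)
    also have "\<dots> = (\<Prod>v\<in>V. \<sigma> v ^ card {e \<in> \<eta>. v \<in> e})"
    proof (rule prod.cong[OF refl])
      fix v
      have "(\<Prod>e\<in>\<eta>. \<sigma> v ^ (if v \<in> e then 1 else 0)) = (\<Prod>e\<in>\<eta>. if v \<in> e then \<sigma> v else 1)"
        by (intro prod.cong) auto
      also have "\<dots> = (\<Prod>e\<in>{e \<in> \<eta>. v \<in> e}. \<sigma> v)"
        by (rule prod.inter_filter[OF assms(2), symmetric])
      finally show "(\<Prod>e\<in>\<eta>. \<sigma> v ^ (if v \<in> e then 1 else 0)) = \<sigma> v ^ card {e \<in> \<eta>. v \<in> e}"
        by simp
    qed
    finally show ?thesis
      by (simp only: spin_eq_prod_powers[OF assms(1,4)] prod.distrib power_add)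
  qed
  then have "(\<Sum>\<sigma>\<in>spin_configs V. spin \<sigma> C * (\<Prod>e\<in>\<eta>. spin \<sigma> e)) =
    (if \<forall>v\<in>V. even ((if v \<in> C then 1 else 0) + card {e \<in> \<eta>. v \<in> e}) then 2 ^ card V else 0)"
    by (simp only: sum_spin_configs_powers[OF assms(1)])
  moreover have "(\<forall>v\<in>V. even ((if v \<in> C then 1 else 0) + card {e \<in> \<eta>. v \<in> e})) \<longleftrightarrow>
      odd_vertices V \<eta> = C"
    using assms(4) unfolding odd_vertices_def by (auto split: if_splits)
  ultimately show ?thesis by simp
qed

text \<open>Handshake lemma: counting incidences by edges shows that the degrees add up to
  \<open>2 * card \<eta>\<close>, so evenly many of them are odd.\<close>

lemma even_card_odd_vertices:
  assumes "finite_graph V E" "\<eta> \<subseteq> E"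
  shows "even (card (odd_vertices V \<eta>))"
proof -
  have V: "finite V" and \<eta>: "finite \<eta>"
    using assms finite_subset[OF assms(2) finite_graph_edges_finite[OF assms(1)]]
    by (auto simp: finite_graph_def)
  have edge: "V \<inter> e = e" "card e = 2" if "e \<in> \<eta>" for e
    using assms that by (auto simp: finite_graph_def)
  have "(\<Sum>v\<in>V. card {e \<in> \<eta>. v \<in> e}) = (\<Sum>v\<in>V. \<Sum>e\<in>\<eta>. if v \<in> e then 1 else 0)"
    using \<eta> by (simp flip: sum.inter_filter)
  also have "\<dots> = (\<Sum>e\<in>\<eta>. \<Sum>v\<in>V. if v \<in> e then 1 else 0)" by (rule sum.swap)
  also have "\<dots> = (\<Sum>e\<in>\<eta>. 2)"
    using V edge by (intro sum.cong) (auto simp: sum.inter_restrict[symmetric])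
  finally have "even (\<Sum>v\<in>V. card {e \<in> \<eta>. v \<in> e})" by simp
  then show ?thesis
    using V by (simp add: even_sum_iff odd_vertices_def)
qed

section \<open>Configurations that are constant on components\<close>

lemma connectivity_edge:
  assumes "\<omega> \<subseteq> E" "finite_graph V E" "{u, v} \<in> \<omega>"
  shows "(u, v) \<in> connectivity V \<omega>"
  using assms unfolding connectivity_def finite_graph_def by blast

text \<open>Two spins with product one agree; induction along a path carries this from edges to
  connected pairs.\<close>

lemma constant_on_connected:
  assumes "finite_graph V E" "\<omega> \<subseteq> E" "\<tau> \<in> spin_configs V" "\<forall>e\<in>\<omega>. spin \<tau> e = 1"
    and "(u, v) \<in> connectivity V \<omega>"
  shows "\<tau> u = \<tau> v"
proof -
  have "(u, v) \<in> {(u, v). {u, v} \<in> \<omega>}\<^sup>*" using assms(5) by (simp add: connectivity_def)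
  then show ?thesis
  proof induction
    case (step y z)
    then have yz: "{y, z} \<in> \<omega>" by simp
    \<comment> \<open>Cardinality two excludes \<open>y = z\<close>, so
      \<open>spin \<tau> {y, z}\<close> really is the product of two spins.\<close>
    then have "card {y, z} = 2" "{y, z} \<subseteq> V"
      using assms(1,2) unfolding finite_graph_def by blast+
    then have "y \<noteq> z" "y \<in> V" "z \<in> V" by auto
    moreover have "spin \<tau> {y, z} = 1" using yz assms(4) by blast
    ultimately show ?case
      using step.IH spin_configsD[OF assms(3)] by (fastforce simp: spin_def)
  qed simp
qed

text \<open>The configurations that survive the indicator correspond to sign assignments
  \<open>f\<close> on the components. Under this bijection \<open>spin \<tau> B\<close> becomes the
  monomial in which \<open>f C\<close> has exponent \<open>card (C \<inter> B)\<close>, and the sum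
  over signs is again a parity test.\<close>

lemma sum_spin_constant_on_components:
  assumes G: "finite_graph V E" and \<omega>: "\<omega> \<subseteq> E" and B: "B \<subseteq> V"
  shows "(\<Sum>\<tau>\<in>spin_configs V. spin \<tau> B * of_bool (\<forall>e\<in>\<omega>. spin \<tau> e = 1)) =
    2 ^ card (components V \<omega>) * indicator (even_components V B) \<omega>"
proof -
  let ?R = "connectivity V \<omega>" and ?K = "components V \<omega>"
  let ?T = "{\<tau> \<in> spin_configs V. \<forall>e\<in>\<omega>. spin \<tau> e = 1}"
  define c where "c v = ?R `` {v}" for v
  have V: "finite V" using G by (simp add: finite_graph_def)
  have eq: "equiv V ?R" by (rule equiv_connectivity)
  have K: "finite ?K" unfolding components_def
    using V eq finite_quotient equiv_type by blast
  have cK: "c v \<in> ?K" if "v \<in> V" for v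
    using that by (simp add: c_def components_def quotientI)
  have KV: "C \<subseteq> V" if "C \<in> ?K" for C
    using that Union_quotient[OF eq] by (auto simp: components_def)
  have c_eq: "c v = C" if "C \<in> ?K" "v \<in> C" for C v
    using that quotient_eq_iff[OF eq] unfolding c_def components_def
    by (metis Image_singleton_iff eq equiv_class_eq_iff quotientE)
  have pick: "(SOME v. v \<in> C) \<in> C" if "C \<in> ?K" for C
    using that in_quotient_imp_non_empty[OF eq] unfolding components_def
    by (metis ex_in_conv someI)
  have self: "v \<in> c v" if "v \<in> V" for v
    unfolding c_def using that eq equiv_class_self by metis
  have const: "\<tau> u = \<tau> v" if "\<tau> \<in> ?T" "(u, v) \<in> ?R" for \<tau> u v
    using constant_on_connected[OF G \<omega>] that by blast
  have "(\<Sum>\<tau>\<in>spin_configs V. spin \<tau> B * of_bool (\<forall>e\<in>\<omega>. spin \<tau> e = 1)) = (\<Sum>\<tau>\<in>?T. spin \<tau> B)"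
    using finite_spin_configs[OF V]
    by (subst sum.inter_filter) (simp_all add: of_bool_def if_distrib cong: if_cong)
  also have "\<dots> = (\<Sum>f\<in>spin_configs ?K. spin (\<lambda>v. f (c v)) B)"
  \<comment> \<open>\<open>j\<close> reads off the spin at a chosen representative of each
    component; \<open>i\<close> gives every vertex the sign of its component \<open>c v\<close>. By
    \<open>const\<close> the value read off does not depend on the representative.\<close>
  proof (rule sum.reindex_bij_witness[where
        j = "\<lambda>\<tau>. restrict (\<lambda>C. \<tau> (SOME v. v \<in> C)) ?K" and
        i = "\<lambda>f. restrict (\<lambda>v. f (c v)) V"])
    fix \<tau> assume \<tau>: "\<tau> \<in> ?T"
    have val: "\<tau> (SOME u. u \<in> c v) = \<tau> v" if "v \<in> V" for v
      using const[OF \<tau>, of v "SOME u. u \<in> c v"] pick[OF cK[OF that]] by (simp add: c_def)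
    have \<tau>E: "\<tau> \<in> V \<rightarrow>\<^sub>E {-1, 1}" using \<tau> by (simp add: spin_configs_def)
    show "(\<lambda>v\<in>V. (\<lambda>C\<in>?K. \<tau> (SOME v. v \<in> C)) (c v)) = \<tau>"
      using \<tau>E by (auto simp: fun_eq_iff restrict_def cK val PiE_iff extensional_def)
    show "(\<lambda>C\<in>?K. \<tau> (SOME v. v \<in> C)) \<in> spin_configs ?K"
      using \<tau>E pick KV unfolding spin_configs_def by (intro restrict_PiE_iff[THEN iffD2]) blast
    show "spin (\<lambda>v. (\<lambda>C\<in>?K. \<tau> (SOME v. v \<in> C)) (c v)) B = spin \<tau> B"
      unfolding spin_def using B by (intro prod.cong) (auto simp: cK val subset_iff)
  next
    fix f assume f: "f \<in> spin_configs ?K"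
    then have fE: "f \<in> ?K \<rightarrow>\<^sub>E {-1, 1}" by (simp add: spin_configs_def)
    have "(SOME v. v \<in> C) \<in> V" "c (SOME v. v \<in> C) = C" if "C \<in> ?K" for C
      using pick[OF that] KV[OF that] c_eq[OF that] by auto
    then show "(\<lambda>C\<in>?K. (\<lambda>v\<in>V. f (c v)) (SOME v. v \<in> C)) = f"
      using fE by (auto simp: fun_eq_iff PiE_iff extensional_def)
    have cfg: "(\<lambda>v\<in>V. f (c v)) \<in> spin_configs V"
      unfolding spin_configs_def using fE cK by (intro restrict_PiE_iff[THEN iffD2]) blast
    have "spin (\<lambda>v\<in>V. f (c v)) e = 1" if e: "e \<in> \<omega>" for e
    proof -
      have "card e = 2" "e \<subseteq> V" using G \<omega> e by (auto simp: finite_graph_def)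
      then obtain u v where uv: "e = {u, v}" "u \<noteq> v" "u \<in> V" "v \<in> V"
        by (auto simp: card_2_iff)
      \<comment> \<open>Both endpoints lie in one component, so the edge product is the square of a
        sign.\<close>
      have "(u, v) \<in> ?R" using connectivity_edge[OF \<omega> G] e uv by simp
      then have "c u = c v" unfolding c_def by (rule equiv_class_eq[OF eq])
      moreover have "f (c v) = -1 \<or> f (c v) = 1"
        using spin_configsD[OF f] cK uv(4) by blast
      ultimately show ?thesis using uv by (auto simp: spin_def)
    qed
    then show "(\<lambda>v\<in>V. f (c v)) \<in> ?T" using cfg by blast
  qed
  also have "\<dots> = (\<Sum>f\<in>spin_configs ?K. \<Prod>C\<in>?K. f C ^ card (C \<inter> B))"
  proof (intro sum.cong refl)
    fix f
    \<comment> \<open>Group the vertices of \<open>B\<close> by their component.\<close>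
    have "spin (\<lambda>v. f (c v)) B = (\<Prod>C\<in>?K. \<Prod>v\<in>{v \<in> B. c v = C}. f (c v))"
      unfolding spin_def using B V K cK by (intro prod.group[symmetric]) (auto intro: finite_subset)
    also have "\<dots> = (\<Prod>C\<in>?K. \<Prod>v\<in>C \<inter> B. f C)"
    proof (rule prod.cong[OF refl])
      fix C assume C: "C \<in> ?K"
      have "{v \<in> B. c v = C} = C \<inter> B" using c_eq[OF C] self B by blast
      then show "(\<Prod>v\<in>{v \<in> B. c v = C}. f (c v)) = (\<Prod>v\<in>C \<inter> B. f C)"
        using c_eq[OF C] by (intro prod.cong) auto
    qed
    finally show "spin (\<lambda>v. f (c v)) B = (\<Prod>C\<in>?K. f C ^ card (C \<inter> B))" by simp
  qed
  also have "\<dots> = (if \<forall>C\<in>?K. even (card (C \<inter> B)) then 2 ^ card ?K else 0)"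
    by (rule sum_spin_configs_powers[OF K])
  finally show ?thesis by (simp add: even_components_def indicator_def)
qed

section \<open>Expansion of the Ashkin-Teller weight into currents\<close>

text \<open>For \<open>t = -1\<close> both terms of the exponent vanish. For \<open>t = 1\<close>
  the exponent is \<open>2 * J * s + 2 * U\<close>, and
  \<open>exp (2 * J * s) = cosh (2 * J) + s * sinh (2 * J)\<close>. The final \<open>1\<close> is
  the value common to both cases, hence the \<open>- 1\<close> next to the cosh term.\<close>

lemma edge_weight_expansion:
  fixes s t J U :: real
  assumes "s = 1 \<or> s = -1" "t = 1 \<or> t = -1"
  shows "exp (J * (s + s * t) + U * (s * (s * t) + 1)) =
    of_bool (t = 1) * ((exp (2 * U) * sinh (2 * J)) * s + (exp (2 * U) * cosh (2 * J) - 1)) + 1"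
proof -
  \<comment> \<open>The two identities are the cases \<open>s = 1\<close> and \<open>s = -1\<close>
    for \<open>t = 1\<close>.\<close>
  have "exp (2 * J + 2 * U) = exp (2 * U) * (sinh (2 * J) + cosh (2 * J))"
    by (simp only: sinh_plus_cosh exp_add mult.commute)
  moreover have "exp (2 * U - 2 * J) = exp (2 * U) * (cosh (2 * J) - sinh (2 * J))"
    by (simp add: cosh_minus_sinh flip: exp_add)
  ultimately show ?thesis
    using assms by (auto simp: algebra_simps)
qed

text \<open>The product over edges is expanded twice: \<open>\<omega>\<close> collects the edges
  where the summand \<open>1\<close> is not chosen, and \<open>\<eta>\<close> those edges of
  \<open>\<omega>\<close> where the \<open>x\<close> term is chosen over the \<open>y\<close>
  term.\<close>

lemma at_weight_expansion:
  fixes J U :: "'a set \<Rightarrow> real"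
  assumes G: "finite_graph V E" and \<sigma>: "\<sigma> \<in> spin_configs V" and \<tau>: "\<tau> \<in> spin_configs V"
  defines "x \<equiv> \<lambda>e. exp (2 * U e) * sinh (2 * J e)"
    and "y \<equiv> \<lambda>e. exp (2 * U e) * cosh (2 * J e) - 1"
  shows "at_weight E J U (\<sigma>, \<lambda>v\<in>V. \<sigma> v * \<tau> v) =
    (\<Sum>\<omega>\<in>Pow E. \<Sum>\<eta>\<in>Pow \<omega>. prod x \<eta> * prod y (\<omega> - \<eta>) *
       (\<Prod>e\<in>\<eta>. spin \<sigma> e) * of_bool (\<forall>e\<in>\<omega>. spin \<tau> e = 1))"
proof -
  have E: "finite E" by (rule finite_graph_edges_finite[OF G])
  have sub: "e \<subseteq> V" if "e \<in> E" for e using G that by (simp add: finite_graph_def)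
  have "spin (\<lambda>v\<in>V. \<sigma> v * \<tau> v) e = spin \<sigma> e * spin \<tau> e" if "e \<in> E" for e
  proof -
    have "spin (\<lambda>v\<in>V. \<sigma> v * \<tau> v) e = (\<Prod>v\<in>e. \<sigma> v * \<tau> v)"
      unfolding spin_def using sub[OF that] by (intro prod.cong) auto
    then show ?thesis by (simp add: spin_def prod.distrib)
  qed
  then have "at_weight E J U (\<sigma>, \<lambda>v\<in>V. \<sigma> v * \<tau> v) =
      (\<Prod>e\<in>E. of_bool (spin \<tau> e = 1) * (x e * spin \<sigma> e + y e) + 1)"
    unfolding at_weight_def x_def y_def prod.case
    using spin_cases[OF \<sigma> sub] spin_cases[OF \<tau> sub]
    by (intro prod.cong refl) (simp only: edge_weight_expansion)
  also have "\<dots> = (\<Sum>\<omega>\<in>Pow E. \<Prod>e\<in>\<omega>. of_bool (spin \<tau> e = 1) * (x e * spin \<sigma> e + y e))"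
    by (simp add: prod_add[OF E])
  also have "\<dots> = (\<Sum>\<omega>\<in>Pow E. \<Sum>\<eta>\<in>Pow \<omega>. prod x \<eta> * prod y (\<omega> - \<eta>) *
       (\<Prod>e\<in>\<eta>. spin \<sigma> e) * of_bool (\<forall>e\<in>\<omega>. spin \<tau> e = 1))"
  proof (intro sum.cong refl)
    fix \<omega> assume "\<omega> \<in> Pow E"
    then have \<omega>: "finite \<omega>" using E finite_subset by auto
    have "(\<Prod>e\<in>\<omega>. of_bool (spin \<tau> e = 1) * (x e * spin \<sigma> e + y e)) =
        of_bool (\<forall>e\<in>\<omega>. spin \<tau> e = 1) * (\<Sum>\<eta>\<in>Pow \<omega>. (\<Prod>e\<in>\<eta>. x e * spin \<sigma> e) * prod y (\<omega> - \<eta>))"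
    proof (cases "\<forall>e\<in>\<omega>. spin \<tau> e = 1")
      case True
      then have "(\<Prod>e\<in>\<omega>. of_bool (spin \<tau> e = 1) * (x e * spin \<sigma> e + y e)) =
          (\<Prod>e\<in>\<omega>. x e * spin \<sigma> e + y e)"
        by (intro prod.cong) auto
      then show ?thesis using True by (simp add: prod_add[OF \<omega>])
    next
      case False
      then have "(\<Prod>e\<in>\<omega>. of_bool (spin \<tau> e = 1) * (x e * spin \<sigma> e + y e)) = 0"
        using \<omega> by (intro prod_zero) auto
      with False show ?thesis by (simp only: of_bool_eq mult_zero_left)
    qed
    then show "(\<Prod>e\<in>\<omega>. of_bool (spin \<tau> e = 1) * (x e * spin \<sigma> e + y e)) =
      (\<Sum>\<eta>\<in>Pow \<omega>. prod x \<eta> * prod y (\<omega> - \<eta>) *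
         (\<Prod>e\<in>\<eta>. spin \<sigma> e) * of_bool (\<forall>e\<in>\<omega>. spin \<tau> e = 1))"
      by (simp add: sum_distrib_left prod.distrib mult_ac)
  qed
  finally show ?thesis .
qed

section \<open>Change of variables and summation over currents\<close>

text \<open>Pointwise multiplication by \<open>\<sigma>\<close> is an involution of the
  configurations, since spins square to one.\<close>

lemma sum_spin_configs_mult:
  fixes g :: "('a \<Rightarrow> real) \<Rightarrow> real"
  assumes \<sigma>: "\<sigma> \<in> spin_configs V"
  shows "(\<Sum>\<sigma>'\<in>spin_configs V. g \<sigma>') = (\<Sum>\<tau>\<in>spin_configs V. g (\<lambda>v\<in>V. \<sigma> v * \<tau> v))"
proof -
  have sq: "\<sigma> v * (\<sigma> v * r) = r" if "v \<in> V" for v r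
    using spin_configsD[OF \<sigma> that] by auto
  have inv: "(\<lambda>v\<in>V. \<sigma> v * (\<lambda>v\<in>V. \<sigma> v * \<tau> v) v) = \<tau>" if "\<tau> \<in> spin_configs V" for \<tau>
    using that by (auto simp: fun_eq_iff sq spin_configs_def PiE_iff extensional_def)
  have mem: "(\<lambda>v\<in>V. \<sigma> v * \<tau> v) \<in> spin_configs V" if "\<tau> \<in> spin_configs V" for \<tau>
    unfolding spin_configs_def restrict_PiE_iff
    using spin_configsD[OF \<sigma>] spin_configsD[OF that] by fastforce
  show ?thesis
    by (rule sum.reindex_bij_witness[where i = "\<lambda>\<tau>. \<lambda>v\<in>V. \<sigma> v * \<tau> v" and
          j = "\<lambda>\<tau>. \<lambda>v\<in>V. \<sigma> v * \<tau> v"]) (simp_all only: inv mem)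
qed

lemma sum_currents:
  assumes "finite_graph V E"
  shows "(\<Sum>(\<omega>, \<eta>)\<in>currents V E C. g \<omega> \<eta>) =
    (\<Sum>\<omega>\<in>Pow E. \<Sum>\<eta>\<in>Pow \<omega>. if odd_vertices V \<eta> = C then g \<omega> \<eta> else (0::real))"
proof -
  have E: "finite E" by (rule finite_graph_edges_finite[OF assms])
  have \<omega>: "finite (Pow \<omega>)" if "\<omega> \<in> Pow E" for \<omega> using E that finite_subset by auto
  \<comment> \<open>For odd \<open>card C\<close> both sides are empty, by the handshake
    lemma.\<close>
  have cur: "currents V E C = {n \<in> Sigma (Pow E) Pow. odd_vertices V (snd n) = C}"
    using even_card_odd_vertices[OF assms] unfolding currents_def by (cases "even (card C)") auto
  have "finite (Sigma (Pow E) Pow)" using E \<omega> by (intro finite_SigmaI) auto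
  then have "(\<Sum>(\<omega>, \<eta>)\<in>currents V E C. g \<omega> \<eta>) =
      (\<Sum>n\<in>Sigma (Pow E) Pow. if odd_vertices V (snd n) = C then case n of (\<omega>, \<eta>) \<Rightarrow> g \<omega> \<eta> else 0)"
    unfolding cur by (rule sum.inter_filter)
  also have "\<dots> = (\<Sum>(\<omega>, \<eta>)\<in>Sigma (Pow E) Pow. if odd_vertices V \<eta> = C then g \<omega> \<eta> else 0)"
    by (intro sum.cong refl) (simp only: split_beta)
  also have "\<dots> = (\<Sum>\<omega>\<in>Pow E. \<Sum>\<eta>\<in>Pow \<omega>. if odd_vertices V \<eta> = C then g \<omega> \<eta> else 0)"
    using E \<omega> by (intro sum.Sigma[symmetric]) auto
  finally show ?thesis .
qed

text \<open>The identity before normalization. The factor \<open>2 ^ card V\<close> comes from the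
  sum over \<open>\<sigma>\<close> and is the same for all \<open>A\<close> and
  \<open>B\<close>.\<close>

lemma sum_at_weight_eq_currents:
  assumes G: "finite_graph V E" and A: "A \<subseteq> V" and B: "B \<subseteq> V"
  shows "(\<Sum>(\<sigma>, \<sigma>')\<in>spin_configs V \<times> spin_configs V.
      at_weight E J U (\<sigma>, \<sigma>') * (spin \<sigma> A * spin \<sigma>' B)) =
    2 ^ card V * (\<Sum>(\<omega>, \<eta>)\<in>currents V E (sym_diff A B).
      current_weight V J U (\<omega>, \<eta>) * indicator (even_components V B) \<omega>)"
proof -
  let ?S = "spin_configs V" and ?C = "sym_diff A B"
  \<comment> \<open>\<open>w\<close> is the current weight without its component factor;
    \<open>f\<close> and \<open>g\<close> separate the dependence on \<open>\<sigma>\<close> from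
    that on \<open>\<tau>\<close>, so that the two spin sums factorize.\<close>
  define w where "w \<omega> \<eta> = (\<Prod>e\<in>\<eta>. exp (2 * U e) * sinh (2 * J e)) *
    (\<Prod>e\<in>\<omega> - \<eta>. exp (2 * U e) * cosh (2 * J e) - 1)" for \<omega> \<eta>
  define f where "f \<sigma> \<eta> = spin \<sigma> ?C * (\<Prod>e\<in>\<eta>. spin \<sigma> e)" for \<sigma> \<eta>
  define g where "g \<tau> \<omega> = spin \<tau> B * of_bool (\<forall>e\<in>\<omega>. spin \<tau> e = 1)" for \<tau> and \<omega> :: "'a set set"
  have V: "finite V" using G by (simp add: finite_graph_def)
  have E: "finite E" by (rule finite_graph_edges_finite[OF G])
  have C: "?C \<subseteq> V" using A B by blast
  have "(\<Sum>(\<sigma>, \<sigma>')\<in>?S \<times> ?S. at_weight E J U (\<sigma>, \<sigma>') * (spin \<sigma> A * spin \<sigma>' B)) =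
      (\<Sum>\<sigma>\<in>?S. \<Sum>\<sigma>'\<in>?S. at_weight E J U (\<sigma>, \<sigma>') * (spin \<sigma> A * spin \<sigma>' B))"
    by (rule sum.cartesian_product[symmetric])
  also have "\<dots> = (\<Sum>\<sigma>\<in>?S. \<Sum>\<tau>\<in>?S. \<Sum>\<omega>\<in>Pow E. \<Sum>\<eta>\<in>Pow \<omega>. w \<omega> \<eta> * f \<sigma> \<eta> * g \<tau> \<omega>)"
  proof (rule sum.cong[OF refl])
    fix \<sigma> assume \<sigma>: "\<sigma> \<in> ?S"
    have "at_weight E J U (\<sigma>, \<lambda>v\<in>V. \<sigma> v * \<tau> v) * (spin \<sigma> A * spin (\<lambda>v\<in>V. \<sigma> v * \<tau> v) B) =
        (\<Sum>\<omega>\<in>Pow E. \<Sum>\<eta>\<in>Pow \<omega>. w \<omega> \<eta> * f \<sigma> \<eta> * g \<tau> \<omega>)" if \<tau>: "\<tau> \<in> ?S" for \<tau>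
    proof -
      have "spin (\<lambda>v\<in>V. \<sigma> v * \<tau> v) B = (\<Prod>v\<in>B. \<sigma> v * \<tau> v)"
        unfolding spin_def using B by (intro prod.cong) auto
      \<comment> \<open>The second spin on \<open>B\<close> is
        \<open>spin \<sigma> B * spin \<tau> B\<close>, and the two \<open>\<sigma>\<close> products
        merge into one over the symmetric difference.\<close>
      then have "spin \<sigma> A * spin (\<lambda>v\<in>V. \<sigma> v * \<tau> v) B = spin \<sigma> ?C * spin \<tau> B"
        by (simp add: spin_sym_diff[OF V \<sigma> A B]) (simp add: spin_def prod.distrib)
      then show ?thesis
        unfolding at_weight_expansion[OF G \<sigma> \<tau>]
        by (simp add: w_def f_def g_def sum_distrib_right sum_distrib_left mult_ac)
    qed
    then show "(\<Sum>\<sigma>'\<in>?S. at_weight E J U (\<sigma>, \<sigma>') * (spin \<sigma> A * spin \<sigma>' B)) =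
        (\<Sum>\<tau>\<in>?S. \<Sum>\<omega>\<in>Pow E. \<Sum>\<eta>\<in>Pow \<omega>. w \<omega> \<eta> * f \<sigma> \<eta> * g \<tau> \<omega>)"
      by (subst sum_spin_configs_mult[OF \<sigma>]) (rule sum.cong[OF refl])
  qed
  also have "\<dots> = (\<Sum>\<sigma>\<in>?S. \<Sum>\<omega>\<in>Pow E. \<Sum>\<eta>\<in>Pow \<omega>. \<Sum>\<tau>\<in>?S. w \<omega> \<eta> * f \<sigma> \<eta> * g \<tau> \<omega>)"
    by (subst sum.swap, subst (2) sum.swap) (rule refl)
  also have "\<dots> = (\<Sum>\<omega>\<in>Pow E. \<Sum>\<eta>\<in>Pow \<omega>. \<Sum>\<sigma>\<in>?S. \<Sum>\<tau>\<in>?S. w \<omega> \<eta> * f \<sigma> \<eta> * g \<tau> \<omega>)"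
    by (subst sum.swap, subst (2) sum.swap) (rule refl)
  also have "\<dots> = (\<Sum>\<omega>\<in>Pow E. \<Sum>\<eta>\<in>Pow \<omega>. w \<omega> \<eta> * (\<Sum>\<sigma>\<in>?S. f \<sigma> \<eta>) * (\<Sum>\<tau>\<in>?S. g \<tau> \<omega>))"
    by (simp add: sum_distrib_left sum_distrib_right mult_ac)
  also have "\<dots> = (\<Sum>\<omega>\<in>Pow E. \<Sum>\<eta>\<in>Pow \<omega>. if odd_vertices V \<eta> = ?C
      then 2 ^ card V * (current_weight V J U (\<omega>, \<eta>) * indicator (even_components V B) \<omega>) else 0)"
  proof (intro sum.cong refl)
    fix \<omega> \<eta> assume "\<omega> \<in> Pow E" "\<eta> \<in> Pow \<omega>"
    then have \<omega>: "\<omega> \<subseteq> E" and \<eta>: "\<eta> \<subseteq> E" by auto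
    have "(\<Sum>\<sigma>\<in>?S. f \<sigma> \<eta>) = (if odd_vertices V \<eta> = ?C then 2 ^ card V else 0)"
      unfolding f_def using \<eta> E G C V
      by (intro sum_spin_times_edges) (auto simp: finite_graph_def intro: finite_subset)
    \<comment> \<open>The power of two obtained here completes \<open>w\<close> to
      \<open>current_weight\<close>.\<close>
    moreover have "(\<Sum>\<tau>\<in>?S. g \<tau> \<omega>) =
        2 ^ card (components V \<omega>) * indicator (even_components V B) \<omega>"
      unfolding g_def by (rule sum_spin_constant_on_components[OF G \<omega> B])
    ultimately show "w \<omega> \<eta> * (\<Sum>\<sigma>\<in>?S. f \<sigma> \<eta>) * (\<Sum>\<tau>\<in>?S. g \<tau> \<omega>) =
      (if odd_vertices V \<eta> = ?C
       then 2 ^ card V * (current_weight V J U (\<omega>, \<eta>) * indicator (even_components V B) \<omega>) else 0)"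
      by (simp add: w_def current_weight_def)
  qed
  also have "\<dots> = 2 ^ card V * (\<Sum>(\<omega>, \<eta>)\<in>currents V E ?C.
      current_weight V J U (\<omega>, \<eta>) * indicator (even_components V B) \<omega>)"
    by (subst sum_currents[OF G, symmetric]) (simp add: sum_distrib_left split_beta)
  finally show ?thesis .
qed

section \<open>Expectations and normalization\<close>

lemma integral_ashkin_teller:
  fixes f :: "('a \<Rightarrow> real) \<times> ('a \<Rightarrow> real) \<Rightarrow> real"
  assumes "finite V"
  shows "integral\<^sup>L (ashkin_teller V E J U) f =
    (\<Sum>s\<in>spin_configs V \<times> spin_configs V. at_weight E J U s * f s) / at_partition V E J U"
  unfolding ashkin_teller_def
  by (subst lebesgue_integral_point_measure_finite)
    (simp_all add: assms finite_spin_configs less_imp_le[OF at_weight_pos]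
      less_imp_le[OF at_partition_pos] sum_divide_distrib)

theorem proposition1:
  fixes V :: "'a set" and E :: "'a set set"
    and J U :: "'a set \<Rightarrow> real"
    and A B :: "'a set"
  assumes "finite_graph V E" and "A \<subseteq> V" and "B \<subseteq> V"
  shows "integral\<^sup>L (ashkin_teller V E J U) (\<lambda>(\<sigma>, \<sigma>'). spin \<sigma> A * spin \<sigma>' B) =
    1 / (\<Sum>n \<in> currents V E {}. current_weight V J U n)
    * (\<Sum>(\<omega>, \<eta>) \<in> currents V E (sym_diff A B).
         current_weight V J U (\<omega>, \<eta>) * indicator (even_components V B) \<omega>)"
proof -
  have V: "finite V" using assms(1) by (simp add: finite_graph_def)
  \<comment> \<open>For \<open>A = B = {}\<close> the spin products are \<open>1\<close> and every
    \<open>\<omega>\<close> lies in \<open>even_components V {}\<close>, so the unnormalized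
    identity computes the partition function. The common factor \<open>2 ^ card V\<close> then
    cancels in the quotient.\<close>
  have "at_partition V E J U = 2 ^ card V * (\<Sum>n \<in> currents V E {}. current_weight V J U n)"
    using sum_at_weight_eq_currents[OF assms(1) empty_subsetI empty_subsetI, of J U]
    by (simp add: at_partition_def spin_def even_components_def split_beta)
  then show ?thesis
    using sum_at_weight_eq_currents[OF assms, of J U]
    by (simp add: integral_ashkin_teller[OF V] split_beta)
qed

end
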